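(* Let $\xi$ be a point of the twisted torus of the doubled $A_1$ BPS structure, and put $z=Z(\alpha)$, $\ell=Z(\alpha)\,\mathbb R_{>0}$, $\theta=\theta(\alpha)=\ln\xi(\alpha)$. Then $$Y_-(t):=\Lambda_{\frac{\theta}{2\pi i}}\left(-\frac{z}{2\pi i t}\right)\qquad\text{and}\qquad Y_+(t):=\Lambda_{1-\frac{\theta}{2\pi i}}^{-1}\left(\frac{z}{2\pi i t}\right)$$ (where $\Lambda^{-1}$ denotes the reciprocal) solve the following problem: find two meromorphic functions $Y_\pm:\mathbb C^*\setminus\pm i\ell\to\mathbb{CP}^1$ such that (0) $Y_\pm$ are holomorphic and non-vanishing away from zeroes/poles at $\frac{z}{\theta(\alpha)\pm 2k\pi i}$, $k\in\mathbb N$; (1) $Y_+(t)=Y_-(t)\cdot(1-\xi(\alpha)e^{-z/t})$ for $t\in\mathbb H_{\ell}$, and $Y_+(t)=Y_-(t)\cdot(1-\xi(-\alpha)e^{z/t})$ for $t\in\mathbb H_{-\ell}$; (2) $\lim_{t\to0}Y_\pm(t)=1$; (3) $Y_\pm(t)$ has at most algebraic growth when $|t|\gg0$.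
   Context: The doubled $A_1$ BPS structure consists of the lattice $\Gamma=\mathbb Z\alpha\oplus\mathbb Z\alpha^\vee$ with the non-degenerate skew-symmetric integral pairing such that $\langle\alpha,\alpha^\vee\rangle=1$; a homomorphism $Z:\Gamma\to\mathbb C$ with $Z(\alpha^\vee)=0$ (and $Z(\alpha)\neq0$); and the map $\Omega:\Gamma\to\mathbb Z$ with $\Omega(\pm\alpha)=1$ and $\Omega=0$ otherwise. Its twisted torus is $\mathbb T=\{\xi:\Gamma\to\mathbb C^*:\xi(\beta+\beta')=(-1)^{\langle\beta,\beta'\rangle}\xi(\beta)\xi(\beta')\}$, and $\ln\xi$ is taken with imaginary part in $[0,2\pi)$. For a ray $l$, $\mathbb H_l=\{v u: v\in l,\ u\in\mathbb C^*,\ -\pi/2<\arg u<\pi/2\}$ is the open half-plane centred on $l$. $\Lambda_x(y)=\Lambda(x,y)=\dfrac{\Gamma(x+y)\,e^{y}}{y^{x+y-\frac12}\,\sqrt{2\pi}}$, where $\Gamma(\cdot)$ is here the Gamma function, regarded, for a chosen branch of the logarithm in $y^{x+y-\frac12}=\exp((x+y-\frac12)\ln y)$, as a family (parametrised by $x$) of meromorphic functions of $y\in\mathbb C^*\setminus\mathbb R_{<0}$.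
   Formalization: In (2) the limit t→0 is taken within each closed subsector of the slit plane at positive angle from the slit; over the whole slit plane it fails, since poles z/(θ+2kπi) of Y_- and zeros z/(θ-2kπi) of Y_+ accumulate at 0. *)

theory Defs
  imports "HOL-Complex_Analysis.Complex_Analysis"
begin

section \<open>The doubled $A_1$ BPS structure\<close>

text \<open>The pair \<open>(a, b)\<close> stands for the element \<open>a \<alpha> + b \<alpha>\<^sup>\<or>\<close> of the charge lattice.\<close>

type_synonym lattice = "int \<times> int"

definition alpha :: lattice where "alpha = (1, 0)"

definition alpha_dual :: lattice where "alpha_dual = (0, 1)"

fun pairing :: "lattice \<Rightarrow> lattice \<Rightarrow> int" where
  "pairing (a, b) (c, d) = a * d - b * c"

locale doubled_A1 =
  fixes Z :: "lattice \<Rightarrow> complex" and Om :: "lattice \<Rightarrow> int"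
  assumes Z_additive: "Modules.additive Z"
    and Z_alpha_dual: "Z alpha_dual = 0"
    and Z_alpha: "Z alpha \<noteq> 0"
    and Om_eq: "Om g = (if g = alpha \<or> g = - alpha then 1 else 0)"

definition twisted_torus :: "(lattice \<Rightarrow> complex) set" where
  "twisted_torus = {\<xi>. (\<forall>g. \<xi> g \<noteq> 0) \<and>
     (\<forall>g h. \<xi> (g + h) = (-1) powi pairing g h * \<xi> g * \<xi> h)}"

text \<open>The logarithm of a nonzero complex number with imaginary part in $[0,2\pi)$.\<close>

definition Ln2pi :: "complex \<Rightarrow> complex" where
  "Ln2pi w = Complex (ln (cmod w)) (Arg2pi w)"


section \<open>Rays, half-planes and sectors\<close>

definition ray :: "complex \<Rightarrow> complex set" where
  "ray v = {v * of_real s | s. s > 0}"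

definition half_plane :: "complex set \<Rightarrow> complex set" where
  "half_plane l = {v * u | v u. v \<in> l \<and> u \<noteq> 0 \<and> - pi / 2 < Arg u \<and> Arg u < pi / 2}"

definition slit_plane :: "complex \<Rightarrow> complex set" where
  "slit_plane v = - {0} - ray v"

text \<open>The closed subsector of the slit plane that stays at angular distance at least
  \<open>\<delta>\<close> from the slit; its axis is the ray opposite to the slit.\<close>

definition closed_subsector :: "complex \<Rightarrow> real \<Rightarrow> complex set" where
  "closed_subsector v \<delta> = {t. t \<noteq> 0 \<and> \<bar>Arg (t / (- v))\<bar> \<le> pi - \<delta>}"


section \<open>The modified Gamma function\<close>

text \<open>The power is the principal one: \<open>y powr a = exp (a * Ln y)\<close> for \<open>y \<noteq> 0\<close>. This is the
  only branch on the slit plane for which \<open>Lambda x y\<close> tends to 1 as \<open>y\<close> tends to infinity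
  away from the negative real axis.\<close>

definition Lambda :: "complex \<Rightarrow> complex \<Rightarrow> complex" where
  "Lambda x y = Gamma (x + y) * exp y / (y powr (x + y - 1 / 2) * of_real (sqrt (2 * pi)))"


section \<open>The Riemann-Hilbert problem\<close>

text \<open>
  Functions with values in the projective line are represented by
  \<^const>\<open>nicely_meromorphic_on\<close>: the value at a pole is the dummy 0, and at every other
  point the function is continuous. The jump relations are identities of meromorphic functions
  and are therefore stated away from the poles.

  Both \<open>Yp\<close> and \<open>Ym\<close> have the same set of exceptional points, which contains
  both families $z/(\theta + 2k\pi i)$ and $z/(\theta - 2k\pi i)$. If $\theta = 0$, the point
  with $k = 0$ lies at infinity; \<open>z / 0 = 0\<close> is outside the domains and so is harmless.

  Zeros and poles can accumulate at 0 tangentially to the slit, so that a limit over the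
  whole slit plane does not exist. The limit at 0 is taken in each closed subsector.
\<close>

definition exceptional_points :: "complex \<Rightarrow> complex \<Rightarrow> complex set" where
  "exceptional_points z \<theta> =
     (\<Union>k::nat. {z / (\<theta> + 2 * of_nat k * pi * \<i>), z / (\<theta> - 2 * of_nat k * pi * \<i>)})"

definition limit_one_at_0 :: "complex \<Rightarrow> (complex \<Rightarrow> complex) \<Rightarrow> bool" where
  "limit_one_at_0 v Y \<longleftrightarrow>
     (\<forall>\<delta>\<in>{0<..<pi}. (Y \<longlongrightarrow> 1) (at 0 within closed_subsector v \<delta>))"

definition algebraic_growth :: "complex set \<Rightarrow> (complex \<Rightarrow> complex) \<Rightarrow> bool" where
  "algebraic_growth D Y \<longleftrightarrow>
     (\<exists>k::nat. Y \<in> O[inf at_infinity (principal D)](\<lambda>t. t ^ k))"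

definition solves_RH_problem ::
  "(lattice \<Rightarrow> complex) \<Rightarrow> (lattice \<Rightarrow> complex) \<Rightarrow>
     (complex \<Rightarrow> complex) \<Rightarrow> (complex \<Rightarrow> complex) \<Rightarrow> bool" where
  "solves_RH_problem Z \<xi> Yp Ym \<longleftrightarrow>
     (let z = Z alpha; \<theta> = Ln2pi (\<xi> alpha);
          Dp = slit_plane (\<i> * z); Dm = slit_plane (- \<i> * z); S = exceptional_points z \<theta>
      in Yp nicely_meromorphic_on Dp \<and> Ym nicely_meromorphic_on Dm \<and>
         Yp holomorphic_on (Dp - S) \<and> (\<forall>t\<in>Dp - S. Yp t \<noteq> 0) \<and>
         Ym holomorphic_on (Dm - S) \<and> (\<forall>t\<in>Dm - S. Ym t \<noteq> 0) \<and>
         (\<forall>t\<in>half_plane (ray z). \<not> is_pole Yp t \<and> \<not> is_pole Ym t \<longrightarrow>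
            Yp t = Ym t * (1 - \<xi> alpha * exp (- z / t))) \<and>
         (\<forall>t\<in>half_plane (ray (- z)). \<not> is_pole Yp t \<and> \<not> is_pole Ym t \<longrightarrow>
            Yp t = Ym t * (1 - \<xi> (- alpha) * exp (z / t))) \<and>
         limit_one_at_0 (\<i> * z) Yp \<and> limit_one_at_0 (- \<i> * z) Ym \<and>
         algebraic_growth Dp Yp \<and> algebraic_growth Dm Ym)"

end

theory Submission
  imports Defs
begin

text \<open>
  Put \<open>x = \<theta> / (2 \<pi> i)\<close> and \<open>y = - z / (2 \<pi> i t)\<close>. Then \<open>Y\<^sub>- = \<Lambda>\<^sub>x(y)\<close> and
  \<open>1 / Y\<^sub>+ = \<Lambda>\<^bsub>1 - x\<^esub>(- y)\<close>, and the slits in the \<open>t\<close>-plane become the negative real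
  axis for \<open>y\<close> and \<open>- y\<close>. Both jumps are the reflection formula
  \<open>\<Gamma>(x + y) \<Gamma>(1 - x - y) = \<pi> / sin (\<pi> (x + y))\<close>, the sign of \<open>Im y\<close> selecting the branch
  \<open>Ln y - Ln (- y) = \<plusminus> i \<pi>\<close>. The growth at infinity is that of \<open>\<Lambda>\<^sub>x\<close> at \<open>y = 0\<close>, where
  \<open>\<Gamma>(x + y)\<close> has at most a simple pole.

  The limit at \<open>t = 0\<close> is Stirling's formula in a sector. Gudermann's series
  \<open>\<mu>(w) = \<Sum>n. (w + n + 1/2) Ln (1 + 1 / (w + n)) - 1\<close> telescopes, and comparing its partial sums with
  Gauss' product for \<open>\<Gamma>\<close> gives \<open>exp (\<mu>(w)) = C \<Gamma>(w) w\<^bsup>1/2 - w\<^esup> e\<^sup>w\<close> with a constant \<open>C > 0\<close>.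
  Since the terms are \<open>O(|w + n|\<^sup>-\<^sup>2)\<close>, \<open>\<mu>\<close> tends to 0 in sectors, so \<open>\<Lambda>\<^sub>x\<close> has a
  positive limit \<open>K\<close> there, and the reflection formula on the imaginary axis forces \<open>K\<^sup>2 = 1\<close>.
\<close>

section \<open>Stirling's formula in sectors\<close>

abbreviation sector_at_infinity :: "real \<Rightarrow> complex filter" where
  "sector_at_infinity \<delta> \<equiv> inf at_infinity (principal (closed_subsector (- 1) \<delta>))"

text \<open>The axis of \<open>closed_subsector v\<close> is opposite to \<open>v\<close>, so the
  slit direction \<open>- 1\<close> gives a sector centred on the positive reals.\<close>

lemma closed_subsector_iff: "y \<in> closed_subsector (- 1) \<delta> \<longleftrightarrow> y \<noteq> 0 \<and> \<bar>Arg y\<bar> \<le> pi - \<delta>"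
  by (simp add: closed_subsector_def)

text \<open>At the extreme angle pi - \<delta>, with s = sin (\<delta> / 2), the square of |y + r|
  is s^2 (|y| + r)^2 + (1 - s^2) (|y| - r)^2; the second summand is dropped. Hence y + n moves away
  from 0 linearly in n, uniformly in the sector.\<close>

lemma norm_add_ge_in_sector:
  assumes "y \<in> closed_subsector (- 1) \<delta>" "0 < \<delta>" "\<delta> < pi" "0 \<le> r"
  shows "sin (\<delta> / 2) * (cmod y + r) \<le> cmod (y + of_real r)"
proof -
  have "cos (pi - \<delta>) \<le> cos \<bar>Arg y\<bar>"
    using assms by (intro cos_monotone_0_pi_le) (auto simp: closed_subsector_iff)
  then have c: "cos (Arg y) \<ge> - cos \<delta>" by simp
  have Re: "Re y = cmod y * cos (Arg y)"
    by (metis Re_rcis rcis_cmod_Arg)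
  have cd: "cos \<delta> = 1 - 2 * (sin (\<delta>/2))\<^sup>2"
    using cos_double_sin[of "\<delta>/2"] by simp
  have "(cmod (y + of_real r))\<^sup>2 = (cmod y)\<^sup>2 + 2 * r * Re y + r\<^sup>2"
    unfolding cmod_power2 by (simp add: power2_eq_square algebra_simps)
  also have "\<dots> \<ge> (cmod y)\<^sup>2 + 2 * r * (cmod y * (- cos \<delta>)) + r\<^sup>2"
    unfolding Re using c assms by (intro add_mono mult_left_mono) auto
  also have "(cmod y)\<^sup>2 + 2 * r * (cmod y * (- cos \<delta>)) + r\<^sup>2
      = (sin (\<delta>/2) * (cmod y + r))\<^sup>2 + (1 - (sin (\<delta>/2))\<^sup>2) * (cmod y - r)\<^sup>2"
    unfolding cd by (simp add: power2_eq_square algebra_simps)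
  finally have "(cmod (y + of_real r))\<^sup>2 \<ge>
      (sin (\<delta>/2) * (cmod y + r))\<^sup>2 + (1 - (sin (\<delta>/2))\<^sup>2) * (cmod y - r)\<^sup>2" by simp
  moreover have "(1 - (sin (\<delta>/2))\<^sup>2) * (cmod y - r)\<^sup>2 \<ge> 0"
    by (simp add: cos_squared_eq[symmetric])
  ultimately have "(cmod (y + of_real r))\<^sup>2 \<ge> (sin (\<delta>/2) * (cmod y + r))\<^sup>2" by linarith
  then show ?thesis by (rule power2_le_imp_le) simp
qed

section \<open>Gudermann's series: size of the terms and convergence\<close>

lemma Ln_1_plus_approx_quadratic:
  assumes "cmod u \<le> 1 / 2"
  shows "cmod (Ln (1 + u) - (u - u\<^sup>2 / 2)) \<le> 8 * cmod u ^ 3"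
proof -
  let ?S = "cball 0 (1 / 2) :: complex set"
  define f :: "nat \<Rightarrow> complex \<Rightarrow> complex" where
    "f = (\<lambda>i. if i = 0 then \<lambda>w. Ln (1 + w) else if i = 1 then \<lambda>w. 1 / (1 + w)
      else if i = 2 then \<lambda>w. - 1 / (1 + w)\<^sup>2 else (\<lambda>w. 2 / (1 + w) ^ 3))"
  have f: "f 0 = (\<lambda>w. Ln (1 + w))" "f 1 = (\<lambda>w. 1 / (1 + w))"
    "f 2 = (\<lambda>w. - 1 / (1 + w)\<^sup>2)" "f 3 = (\<lambda>w. 2 / (1 + w) ^ 3)"
    unfolding f_def by simp_all
  have ge: "cmod (1 + w) \<ge> 1/2" if "w \<in> ?S" for w
    using that norm_triangle_ineq4[of "1 + w" w] by simp
  have nz: "1 + w \<noteq> 0" if "w \<in> ?S" for w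
    using ge[OF that] by auto
  have "(f 0 has_field_derivative f 1 w) (at w within ?S)" if w: "w \<in> ?S" for w
  proof -
    have "Re (1 + w) > 0" using w abs_Re_le_cmod[of w] by simp
    then have "1 + w \<notin> \<real>\<^sub>\<le>\<^sub>0" by (auto simp: complex_nonpos_Reals_iff)
    then have "((\<lambda>w. Ln (1 + w)) has_field_derivative inverse (1 + w) * (0 + 1)) (at w within ?S)"
      by (intro DERIV_chain2[OF has_field_derivative_Ln] DERIV_add DERIV_const DERIV_ident)
    then show ?thesis unfolding f by (simp only: inverse_eq_divide add_0_left mult_1_right)
  qed
  moreover have "(f 1 has_field_derivative f 2 w) (at w within ?S)" if w: "w \<in> ?S" for w
  proof -
    have "((\<lambda>w. 1 / (1 + w)) has_field_derivative (0 * (1 + w) - 1 * (0 + 1)) / ((1 + w) * (1 + w)))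
        (at w within ?S)"
      by (intro DERIV_divide DERIV_add DERIV_const DERIV_ident nz w)
    moreover have "(0 * (1 + w) - 1 * (0 + 1)) / ((1 + w) * (1 + w)) = - 1 / (1 + w)\<^sup>2"
      by (simp add: power2_eq_square)
    ultimately show ?thesis unfolding f by (simp only:)
  qed
  moreover have "(f 2 has_field_derivative f 3 w) (at w within ?S)" if w: "w \<in> ?S" for w
  proof -
    have "((\<lambda>w. - 1 / (1 + w)\<^sup>2) has_field_derivative
        (0 * (1 + w)\<^sup>2 - - 1 * (of_nat 2 * ((0 + 1) * (1 + w) ^ (2 - Suc 0)))) / ((1 + w)\<^sup>2 * (1 + w)\<^sup>2)) (at w within ?S)"
      using nz[OF w] by (intro DERIV_divide DERIV_power DERIV_add DERIV_const DERIV_ident) auto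
    moreover have "(0 * a\<^sup>2 - - 1 * (of_nat 2 * ((0 + 1) * a ^ (2 - Suc 0)))) / (a\<^sup>2 * a\<^sup>2) = 2 / a ^ 3"
      if "a \<noteq> 0" for a :: complex
      using that by (simp add: power2_eq_square power3_eq_cube)
    note this[OF nz[OF w]]
    ultimately show ?thesis unfolding f by (simp only:)
  qed
  ultimately have deriv: "(f i has_field_derivative f (Suc i) w) (at w within ?S)"
    if "w \<in> ?S" "i \<le> 2" for i w
    using that by (auto simp: le_Suc_eq numeral_2_eq_2 numeral_3_eq_3)
  have bound: "cmod (f (Suc 2) w) \<le> 16" if w: "w \<in> ?S" for w
  proof -
    have "(1/2)^3 \<le> cmod (1 + w) ^ 3" using ge[OF w] by (intro power_mono) auto
    then have "2 / cmod (1 + w) ^ 3 \<le> 2 / (1 / 2) ^ 3"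
      using nz[OF w] by (intro divide_left_mono mult_pos_pos) auto
    moreover have "2 / (1 / 2) ^ 3 = (16 :: real)" by (simp add: power3_eq_cube)
    moreover have "cmod (f (Suc 2) w) = 2 / cmod (1 + w) ^ 3"
      by (simp add: f norm_divide norm_power)
    ultimately show ?thesis by linarith
  qed
  \<comment> \<open>On the disc |1 + w| >= 1/2, so the third derivative is at most 16. The remainder
    in \<open>complex_Taylor\<close> is divided by 2!, not 3!, whence the constant 8.\<close>
  have "cmod (f 0 u - (\<Sum>i\<le>2. f i 0 * (u - 0) ^ i / fact i)) \<le> 16 * cmod (u - 0) ^ Suc 2 / fact 2"
    by (rule complex_Taylor[OF _ deriv bound]) (use assms in simp_all)
  moreover have "(\<Sum>i\<le>2. f i 0 * (u - 0) ^ i / fact i) = f 0 0 + f 1 0 * u + f 2 0 * u\<^sup>2 / 2"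
    by (simp add: numeral_2_eq_2)
  moreover have "\<dots> = u - u\<^sup>2 / 2" unfolding f by simp
  ultimately show ?thesis unfolding f by (simp add: numeral_2_eq_2 numeral_3_eq_3)
qed

definition gudermann_term :: "complex \<Rightarrow> complex" where
  "gudermann_term w = (w + 1 / 2) * Ln (1 + 1 / w) - 1"

text \<open>With u = 1 / w and r the cubic remainder of the logarithm, the 1/2 in the factor w + 1/2
  cancels the term of order u. What is left is r / u + r / 2 - u^2 / 4, and 8 + 2 + 1/4 <=
  11.\<close>

lemma norm_gudermann_term_le:
  assumes "2 \<le> cmod w"
  shows "cmod (gudermann_term w) \<le> 11 / (cmod w)\<^sup>2"
proof -
  define u where "u = 1 / w"
  have nz: "u \<noteq> 0" and w: "w = 1 / u" using assms by (auto simp: u_def)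
  have u: "cmod u \<le> 1/2"
    using assms frac_le[of 1 1 2 "cmod w"] by (simp only: u_def norm_divide norm_one)
  define r where "r = Ln (1 + u) - (u - u\<^sup>2 / 2)"
  have r: "cmod r \<le> 8 * cmod u ^ 3" unfolding r_def by (rule Ln_1_plus_approx_quadratic[OF u])
  have "gudermann_term w = (1 / u + 1 / 2) * (r + (u - u\<^sup>2 / 2)) - 1"
    by (simp add: gudermann_term_def r_def w)
  also have "\<dots> = r / u + r / 2 - u\<^sup>2 / 4"
    using nz by (simp add: field_simps power2_eq_square)
  also have "cmod \<dots> \<le> cmod r / cmod u + cmod r / 2 + (cmod u)\<^sup>2 / 4"
    by (rule order_trans[OF norm_triangle_ineq4])
       (auto intro!: add_mono order_trans[OF norm_triangle_ineq] simp: norm_divide norm_power)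
  also have "\<dots> \<le> 8 * (cmod u)\<^sup>2 + 4 * cmod u ^ 3 + (cmod u)\<^sup>2 / 4"
    using r nz by (intro add_mono) (auto simp: field_simps eval_nat_numeral)
  also have "4 * cmod u ^ 3 \<le> 2 * (cmod u)\<^sup>2"
    using mult_right_mono[OF u, of "4 * (cmod u)\<^sup>2"] by (simp add: eval_nat_numeral)
  also have "8 * (cmod u)\<^sup>2 + 2 * (cmod u)\<^sup>2 + (cmod u)\<^sup>2 / 4 \<le> 11 * (cmod u)\<^sup>2"
    by simp
  finally show ?thesis by (simp add: u_def norm_divide power_divide)
qed

text \<open>The exponent -2 is split as -1/2 - 3/2: one factor keeps decay in \<open>R\<close>, the
  other remains summable in \<open>n\<close>.\<close>

lemma sum_inverse_square_bound:
  fixes R :: real and n :: nat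
  assumes "1 \<le> R"
  shows "1 / (R + n)\<^sup>2 \<le> R powr (- 1 / 2) * real (Suc n) powr (- 3 / 2)"
proof -
  have pos: "R + n > 0" using assms by simp
  have "1 / (R + n)\<^sup>2 = (R + n) powr (- 2)"
    using pos by (simp add: powr_minus powr_numeral divide_inverse)
  also have "\<dots> = (R + n) powr (- 1 / 2) * (R + n) powr (- 3 / 2)"
    by (simp flip: powr_add)
  also have "\<dots> \<le> R powr (- 1 / 2) * real (Suc n) powr (- 3 / 2)"
    using assms by (intro mult_mono powr_mono2') auto
  finally show ?thesis .
qed

lemma summable_Suc_powr_three_halves: "summable (\<lambda>n. real (Suc n) powr (- 3 / 2))"
  by (subst summable_Suc_iff) (simp add: summable_real_powr_iff)

text \<open>Binet's function mu, the remainder in log Gamma(z) = (z - 1/2) log z - z + log (2 pi) /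
  2 + mu(z) off the nonpositive real axis.\<close>

definition binet :: "complex \<Rightarrow> complex" where
  "binet z = (\<Sum>n. gudermann_term (z + of_nat n))"

text \<open>By \<open>far\<close> every |z + n| is at least c (R + n) >= 2, so a single majorant
  gives both convergence and size. Its factor R^(-1/2) is what later sends \<open>binet\<close> to
  0.\<close>

lemma binet_bound:
  fixes R c :: real
  assumes R: "1 \<le> R" and "c > 0" and far: "\<And>n::nat. c * (R + n) \<le> cmod (z + of_nat n)"
    and "2 \<le> c * R"
  shows "summable (\<lambda>n. gudermann_term (z + of_nat n))"
    and "cmod (binet z) \<le> 11 / c\<^sup>2 * R powr (- 1 / 2) * (\<Sum>n. real (Suc n) powr (- 3 / 2))"
proof -
  define b where "b = (\<lambda>n. 11 / c\<^sup>2 * R powr (- 1 / 2) * real (Suc n) powr (- 3 / 2))"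
  have le: "cmod (gudermann_term (z + of_nat n)) \<le> b n" for n :: nat
  proof -
    have "2 \<le> c * (R + n)" using assms(4) \<open>c > 0\<close> by (simp add: algebra_simps add_increasing2)
    then have "cmod (gudermann_term (z + of_nat n)) \<le> 11 / (cmod (z + of_nat n))\<^sup>2"
      using far[of n] by (intro norm_gudermann_term_le) linarith
    also have "\<dots> \<le> 11 / (c * (R + n))\<^sup>2"
      using far[of n] \<open>2 \<le> c * (R + n)\<close> by (intro divide_left_mono power_mono mult_pos_pos) auto
    also have "\<dots> = 11 / c\<^sup>2 * (1 / (R + n)\<^sup>2)" by (simp add: power_mult_distrib)
    also have "\<dots> \<le> 11 / c\<^sup>2 * (R powr (- 1 / 2) * real (Suc n) powr (- 3 / 2))"
      by (intro mult_left_mono sum_inverse_square_bound R) auto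
    finally show ?thesis by (simp add: b_def mult.assoc)
  qed
  have b: "summable b"
    unfolding b_def by (intro summable_mult summable_Suc_powr_three_halves)
  show "summable (\<lambda>n. gudermann_term (z + of_nat n))"
    by (rule summable_comparison_test'[OF b]) (use le in auto)
  have "cmod (binet z) \<le> suminf b"
    unfolding binet_def by (rule norm_suminf_le[OF _ b]) (use le in auto)
  also have "\<dots> = 11 / c\<^sup>2 * R powr (- 1 / 2) * (\<Sum>n. real (Suc n) powr (- 3 / 2))"
    unfolding b_def by (intro suminf_mult summable_Suc_powr_three_halves)
  finally show "cmod (binet z) \<le> 11 / c\<^sup>2 * R powr (- 1 / 2) * (\<Sum>n. real (Suc n) powr (- 3 / 2))" .
qed

text \<open>Dropping the first m >= |z| + 2 terms leaves |z + m + n| >= 2 + n. The dropped terms may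
  contain the default values of \<open>1 / 0\<close> or \<open>Ln 0\<close>, so \<open>z\<close> is
  arbitrary.\<close>

lemma summable_gudermann: "summable (\<lambda>n. gudermann_term (z + of_nat n))"
proof -
  obtain m :: nat where m: "cmod z + 2 \<le> m" using real_arch_simple by blast
  have "summable (\<lambda>n. gudermann_term (z + of_nat m + of_nat n))"
  proof (rule binet_bound(1)[of 2 1])
    fix n :: nat
    have "cmod (z + of_nat m + of_nat n) \<ge> real (m + n) - cmod z"
      using norm_diff_ineq[of "of_nat (m + n)" z] unfolding norm_of_nat by (simp add: algebra_simps)
    then show "1 * (2 + real n) \<le> cmod (z + of_nat m + of_nat n)"
      using m by simp
  qed auto
  then have "summable (\<lambda>n. gudermann_term (z + of_nat (n + m)))"
    by (simp add: add_ac)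
  then show ?thesis by (subst (asm) summable_iff_shift)
qed

text \<open>No multiple of \<open>2 \<pi> i\<close> intervenes: \<open>w\<close> and \<open>w + 1\<close> lie on the same side of the real axis.\<close>

lemma Ln_1_plus_inverse:
  assumes "w \<notin> \<real>\<^sub>\<le>\<^sub>0"
  shows "Ln (1 + 1 / w) = Ln (w + 1) - Ln w"
proof -
  have nz: "w \<noteq> 0" "w + 1 \<noteq> 0" using assms
    by (auto simp: complex_nonpos_Reals_iff complex_eq_iff)
  have "exp (Ln (w + 1) - Ln w) = 1 + 1 / w"
    using nz by (simp add: exp_diff field_simps)
  moreover have "- pi < Im (Ln (w + 1) - Ln w) \<and> Im (Ln (w + 1) - Ln w) < pi"
  proof (cases "Im w" "0::real" rule: linorder_cases)
    case equal
    then have "Re w > 0" using assms by (auto simp: complex_nonpos_Reals_iff)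
    then have "Im (Ln (w + 1)) = 0" "Im (Ln w) = 0"
      using equal nz by (simp_all add: Im_Ln_eq_0)
    then show ?thesis by simp
  next
    case less
    then have "Im (Ln (w + 1)) < 0" "Im (Ln w) < 0"
      using nz Im_Ln_pos_le[of w] Im_Ln_pos_le[of "w+1"] Im_Ln_le_pi[of w] Im_Ln_le_pi[of "w+1"] by auto
    then show ?thesis using mpi_less_Im_Ln[of w] mpi_less_Im_Ln[of "w+1"] nz by auto
  next
    case greater
    then show ?thesis using Im_Ln_pos_lt_imp[of w] Im_Ln_pos_lt_imp[of "w+1"] by auto
  qed
  ultimately show ?thesis by (intro Ln_unique) auto
qed

section \<open>From Gudermann's series to the Gamma function\<close>

text \<open>The term at w is the increment of (w - 1/2) Ln w from w to w + 1, minus Ln w, minus 1.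
  The increments telescope, and the summands - Ln w exponentiate to the reciprocal of the Pochhammer
  product.\<close>

lemma exp_sum_gudermann:
  assumes "z \<notin> \<real>\<^sub>\<le>\<^sub>0"
  shows "exp (\<Sum>n<N. gudermann_term (z + of_nat n)) =
    exp ((z + of_nat N - 1 / 2) * Ln (z + of_nat N) - (z - 1 / 2) * Ln z - of_nat N) / pochhammer z N"
proof (induction N)
  case (Suc N)
  have w: "z + of_nat N \<notin> \<real>\<^sub>\<le>\<^sub>0" using assms by (auto simp: complex_nonpos_Reals_iff)
  then have nz: "z + of_nat N \<noteq> 0" by auto
  have "gudermann_term (z + of_nat N) =
      (z + of_nat (Suc N) - 1/2) * Ln (z + of_nat (Suc N)) - (z + of_nat N - 1/2) * Ln (z + of_nat N)
      - Ln (z + of_nat N) - 1"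
    unfolding gudermann_term_def Ln_1_plus_inverse[OF w] by (simp add: algebra_simps)
  then have "exp (\<Sum>n<Suc N. gudermann_term (z + of_nat n)) =
     exp ((z + of_nat N - 1 / 2) * Ln (z + of_nat N) - (z - 1 / 2) * Ln z - of_nat N) / pochhammer z N *
     exp ((z + of_nat (Suc N) - 1/2) * Ln (z + of_nat (Suc N)) - (z + of_nat N - 1/2) * Ln (z + of_nat N)
      - Ln (z + of_nat N) - 1)"
    by (simp add: Suc exp_add)
  also have "\<dots> = exp ((z + of_nat N - 1 / 2) * Ln (z + of_nat N) - (z - 1 / 2) * Ln z - of_nat N +
     ((z + of_nat (Suc N) - 1/2) * Ln (z + of_nat (Suc N)) - (z + of_nat N - 1/2) * Ln (z + of_nat N) - 1)
      - Ln (z + of_nat N)) / pochhammer z N"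
    by (simp add: exp_add[symmetric] algebra_simps)
  also have "\<dots> = exp ((z + of_nat (Suc N) - 1 / 2) * Ln (z + of_nat (Suc N)) - (z - 1 / 2) * Ln z - of_nat (Suc N))
        / pochhammer z (Suc N)"
    using nz by (subst exp_diff) (simp add: pochhammer_Suc algebra_simps)
  finally show ?case .
qed (use assms in auto)

text \<open>The product splits into y Ln (1 + x / y), which tends to x by the linear approximation
  of the logarithm, and (x - 1/2) Ln (1 + x / y), which tends to 0. The hypothesis
  \<open>Ln_eq\<close> excludes a jump of the branch between y and x + y.\<close>

lemma tendsto_shifted_power_exponent:
  fixes x :: complex
  assumes F: "F \<le> at_infinity" and Ln_eq: "\<forall>\<^sub>F y in F. Ln (x + y) - Ln y = Ln (1 + x / y)"
  shows "((\<lambda>y. (x + y - 1 / 2) * (Ln (x + y) - Ln y)) \<longlongrightarrow> x) F"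
proof -
  have u: "((\<lambda>y. x / y) \<longlongrightarrow> 0) F"
    by (rule tendsto_mono[OF F]) (intro tendsto_divide_0[OF tendsto_const] filterlim_ident)
  have ln: "((\<lambda>y. Ln (1 + x / y)) \<longlongrightarrow> Ln (1 + 0)) F"
    by (intro tendsto_intros u) auto
  have "((\<lambda>y. y * Ln (1 + x / y) - x) \<longlongrightarrow> 0) F"
  proof (rule Lim_null_comparison)
    show "((\<lambda>y. cmod x * cmod (x / y) / (1 - cmod (x / y))) \<longlongrightarrow> 0) F"
      by (rule tendsto_eq_intros u refl | simp)+
    have "\<forall>\<^sub>F y in F. cmod (x / y) < 1"
      using order_tendstoD(2)[OF tendsto_norm[OF u], of 1] by simp
    moreover have "\<forall>\<^sub>F y in F. y \<noteq> 0"
      using F eventually_not_equal_at_infinity filter_leD by blast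
    ultimately show "\<forall>\<^sub>F y in F. norm (y * Ln (1 + x / y) - x) \<le> cmod x * cmod (x / y) / (1 - cmod (x / y))"
    proof eventually_elim
      case (elim y)
      have "norm (y * Ln (1 + x / y) - x) = cmod y * cmod (Ln (1 + x / y) - x / y)"
        using elim by (simp flip: norm_mult add: algebra_simps)
      also have "\<dots> \<le> cmod y * (cmod (x / y) ^ 2 / (1 - cmod (x / y)))"
        using elim by (intro mult_left_mono Ln_approx_linear) auto
      also have "\<dots> = cmod x * cmod (x / y) / (1 - cmod (x / y))"
        using elim by (simp add: norm_divide power2_eq_square)
      finally show ?case .
    qed
  qed
  from tendsto_add[OF tendsto_add[OF this tendsto_const[of x]] tendsto_mult[OF tendsto_const[of "x - 1/2"] ln]]
  have "((\<lambda>y. y * Ln (1 + x / y) + (x - 1/2) * Ln (1 + x / y)) \<longlongrightarrow> x) F" by simp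
  moreover have "\<forall>\<^sub>F y in F. y * Ln (1 + x / y) + (x - 1/2) * Ln (1 + x / y)
       = (x + y - 1 / 2) * (Ln (x + y) - Ln y)"
    using Ln_eq by eventually_elim (simp add: algebra_simps)
  ultimately show ?thesis by (rule Lim_transform_eventually)
qed

text \<open>Arg y keeps distance \<delta> from pi and - pi, while the argument of 1 + x / y
  eventually drops below \<delta> in absolute value; their sum stays in the principal range.\<close>

lemma eventually_Ln_shift_sector:
  assumes "0 < \<delta>"
  shows "\<forall>\<^sub>F y in sector_at_infinity \<delta>. Ln (x + y) - Ln y = Ln (1 + x / y)"
proof -
  let ?F = "sector_at_infinity \<delta>"
  have "((\<lambda>y. x / y) \<longlongrightarrow> 0) at_infinity"
    by (intro tendsto_divide_0[OF tendsto_const] filterlim_ident)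
  then have u: "((\<lambda>y. x / y) \<longlongrightarrow> 0) ?F" by (rule tendsto_mono[rotated]) simp
  have "((\<lambda>y. \<bar>Im (Ln (1 + x / y))\<bar>) \<longlongrightarrow> \<bar>Im (Ln (1 + 0))\<bar>) ?F"
    by (intro tendsto_intros u) auto
  then have "\<forall>\<^sub>F y in ?F. \<bar>Im (Ln (1 + x / y))\<bar> < \<delta>"
    by (rule order_tendstoD(2)) (use assms in auto)
  moreover have "\<forall>\<^sub>F y in ?F. y \<in> closed_subsector (- 1) \<delta>"
    by (simp add: eventually_inf_principal)
  moreover have "\<forall>\<^sub>F y in ?F. cmod (x / y) < 1"
    using order_tendstoD(2)[OF tendsto_norm[OF u], of 1] by simp
  ultimately show ?thesis
  proof eventually_elim
    case (elim y)
    then have nz: "y \<noteq> 0" and A: "\<bar>Arg y\<bar> \<le> pi - \<delta>" by (auto simp: closed_subsector_iff)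
    have "1 + x / y \<noteq> 0"
      using elim(3) by (metis add_eq_0_iff less_irrefl norm_minus_cancel norm_one)
    then have "Ln (y * (1 + x / y)) = Ln y + Ln (1 + x / y)"
      using nz A elim(1) by (intro Ln_times_simple) (auto simp: Arg_eq_Im_Ln)
    then show ?case using nz by (simp add: algebra_simps)
  qed
qed

lemma tendsto_shifted_power_of_nat:
  "(\<lambda>N. (z + of_nat N - 1 / 2) * (Ln (z + of_nat N) - Ln (of_nat N))) \<longlonglongrightarrow> z"
proof -
  have "of_nat N \<in> closed_subsector (- 1) (pi / 2)" if "N > 0" for N :: nat
    using that Arg_of_real[of "of_nat N"] by (simp add: closed_subsector_iff)
  then have "\<forall>\<^sub>F N in sequentially. of_nat N \<in> closed_subsector (- 1) (pi / 2)"
    by (intro eventually_mono[OF eventually_gt_at_top[of 0]])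
  then have "filterlim of_nat (sector_at_infinity (pi / 2)) sequentially"
    by (simp add: filterlim_inf filterlim_principal tendsto_of_nat)
  from filterlim_compose[OF tendsto_shifted_power_exponent[OF _ eventually_Ln_shift_sector] this]
  show ?thesis by simp
qed


text \<open>Dividing the exponential of the partial sum by Gauss' approximant, corrected by factors
  whose limits are known, leaves a sequence of nonnegative reals independent of \<open>z\<close>.
  Its limit is therefore one constant for all \<open>z\<close>.\<close>

lemma exp_binet_eq_Gamma:
  obtains C :: real where "C > 0"
    "\<And>z. z \<notin> \<real>\<^sub>\<le>\<^sub>0 \<Longrightarrow> exp (binet z) = of_real C * Gamma z * exp (z - (z - 1 / 2) * Ln z)"
proof -
  \<comment> \<open>The factor \<open>fact (N - 1)\<close> is that of \<open>Gamma_series'\<close>,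
    whose denominator \<open>pochhammer z N\<close> matches the partial sum over
    \<open>n < N\<close>.\<close>
  define a where "a = (\<lambda>N. exp ((real N - 1 / 2) * ln (real N) - real N) / fact (N - 1))"
  define E where "E = (\<lambda>z::complex. Gamma z * exp (z - (z - 1 / 2) * Ln z))"
  have E_nz: "E z \<noteq> 0" if "z \<notin> \<real>\<^sub>\<le>\<^sub>0" for z
    using that nonpos_Ints_subset_nonpos_Reals by (auto simp: E_def Gamma_eq_zero_iff)
  have lim: "(\<lambda>N. of_real (a N)) \<longlonglongrightarrow> exp (binet z) / E z" if z: "z \<notin> \<real>\<^sub>\<le>\<^sub>0" for z
  proof -
    define f where "f = (\<lambda>N. Gamma_series' z N *
        exp ((z + of_nat N - 1 / 2) * (Ln (z + of_nat N) - Ln (of_nat N)) - z) * exp (z - (z - 1 / 2) * Ln z))"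
    have "f \<longlonglongrightarrow> Gamma z * exp (z - z) * exp (z - (z - 1 / 2) * Ln z)"
      unfolding f_def
      by (intro tendsto_intros Gamma_series'_LIMSEQ tendsto_shifted_power_of_nat)
    then have f: "f \<longlonglongrightarrow> E z" by (simp add: E_def)
    have "(\<lambda>N. exp (\<Sum>n<N. gudermann_term (z + of_nat n))) \<longlonglongrightarrow> exp (binet z)"
      unfolding binet_def by (intro tendsto_intros summable_LIMSEQ summable_gudermann)
    then have quot: "(\<lambda>N. exp (\<Sum>n<N. gudermann_term (z + of_nat n)) / f N) \<longlonglongrightarrow> exp (binet z) / E z"
      by (intro tendsto_divide f E_nz z)
    have "\<forall>\<^sub>F N in sequentially. f N \<noteq> 0"
      using tendsto_imp_eventually_ne[OF f E_nz[OF z]] .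
    then have "\<forall>\<^sub>F N in sequentially.
        exp (\<Sum>n<N. gudermann_term (z + of_nat n)) / f N = of_real (a N)"
      using eventually_gt_at_top[of 0]
    proof eventually_elim
      case (elim N)
      define P where "P = (pochhammer z N :: complex)"
      define G where "G = (fact (N - 1) :: complex)"
      have "G \<noteq> 0" by (simp add: G_def)
      have a: "of_real (a N) = exp ((of_nat N - 1 / 2) * Ln (of_nat N) - of_nat N) / G"
        using elim by (simp add: a_def G_def flip: exp_of_real)
      have "f N * of_real (a N) = exp (z * Ln (of_nat N)
          + ((z + of_nat N - 1 / 2) * (Ln (z + of_nat N) - Ln (of_nat N)) - z)
          + (z - (z - 1 / 2) * Ln z) + ((of_nat N - 1 / 2) * Ln (of_nat N) - of_nat N)) / P"
        unfolding f_def Gamma_series'_def a exp_add G_def[symmetric] P_def[symmetric]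
        using \<open>G \<noteq> 0\<close> elim by simp
      also have "\<dots> = exp ((z + of_nat N - 1 / 2) * Ln (z + of_nat N) - (z - 1 / 2) * Ln z - of_nat N) / P"
        by (simp add: algebra_simps)
      also have "\<dots> = exp (\<Sum>n<N. gudermann_term (z + of_nat n))"
        unfolding P_def by (rule exp_sum_gudermann[OF z, symmetric])
      finally show ?case using elim by (simp add: field_simps)
    qed
    with quot show ?thesis by (rule Lim_transform_eventually)
  qed
  \<comment> \<open>The limit is read off at z = 1, which also shows that it is nonzero; uniqueness
    of limits carries it to every z.\<close>
  define L where "L = exp (binet 1) / E 1"
  have L: "(\<lambda>N. of_real (a N)) \<longlonglongrightarrow> L" and "L \<noteq> 0"
    using lim[of 1] E_nz[of 1] by (simp_all add: L_def)
  have "L \<in> \<real>" by (rule Lim_in_closed_set[OF closed_complex_Reals _ _ L]) auto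
  then have L_Re: "L = of_real (Re L)" by simp
  have "a \<longlonglongrightarrow> Re L" using tendsto_Re[OF L] by simp
  then have "Re L \<ge> 0" by (rule LIMSEQ_le_const) (auto simp: a_def)
  moreover have "Re L \<noteq> 0" using L_Re \<open>L \<noteq> 0\<close> by auto
  ultimately have "Re L > 0" by simp
  moreover have "exp (binet z) = of_real (Re L) * Gamma z * exp (z - (z - 1 / 2) * Ln z)"
    if z: "z \<notin> \<real>\<^sub>\<le>\<^sub>0" for z
  proof -
    have "exp (binet z) / E z = L" by (rule LIMSEQ_unique[OF lim[OF z] L])
    then show ?thesis using E_nz[OF z] L_Re by (simp add: field_simps E_def)
  qed
  ultimately show ?thesis by (rule that)
qed

text \<open>In the sector |x + y + r| >= c / 2 (|y| + r) once |y| is large, so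
  \<open>binet_bound\<close> with \<open>R = cmod y\<close> bounds \<open>binet\<close> by a
  multiple of |y|^(-1/2).\<close>

lemma binet_shift_tendsto_0:
  assumes \<delta>: "0 < \<delta>" "\<delta> < pi"
  shows "((\<lambda>y. binet (x + y)) \<longlongrightarrow> 0) (sector_at_infinity \<delta>)"
    and "\<forall>\<^sub>F y in sector_at_infinity \<delta>. x + y \<notin> \<real>\<^sub>\<le>\<^sub>0"
proof -
  let ?F = "sector_at_infinity \<delta>"
  define c where "c = sin (\<delta> / 2)"
  have c: "c > 0" unfolding c_def using \<delta> by (intro sin_gt_zero) auto
  define K where "K = 11 / (c / 2)\<^sup>2 * (\<Sum>n. real (Suc n) powr (- 3 / 2))"
  have inf: "filterlim cmod at_top ?F"
    by (rule filterlim_mono[OF filterlim_norm_at_top order.refl]) simp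
  \<comment> \<open>The thresholds make |x| at most c |y| / 2, make c |y| / 2 at least 2, and make
    |y| at least 1, the last two being conditions of \<open>binet_bound\<close>.\<close>
  have "\<forall>\<^sub>F y in ?F. cmod y \<ge> 2 * cmod x / c" "\<forall>\<^sub>F y in ?F. cmod y \<ge> 4 / c" "\<forall>\<^sub>F y in ?F. cmod y \<ge> 1"
    using inf by (auto simp: filterlim_at_top)
  moreover have "\<forall>\<^sub>F y in ?F. y \<in> closed_subsector (- 1) \<delta>"
    by (simp add: eventually_inf_principal)
  ultimately have ev: "\<forall>\<^sub>F y in ?F. x + y \<notin> \<real>\<^sub>\<le>\<^sub>0 \<and> cmod (binet (x + y)) \<le> K * cmod y powr (- 1 / 2)"
  proof eventually_elim
    case (elim y)
    have far: "c / 2 * (cmod y + r) \<le> cmod (x + y + of_real r)" if "r \<ge> 0" for r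
    proof -
      have "c * (cmod y + r) \<le> cmod (y + of_real r)"
        unfolding c_def using elim \<delta> that by (intro norm_add_ge_in_sector) auto
      moreover have "cmod x \<le> c / 2 * cmod y" using elim c by (simp add: field_simps)
      moreover have "cmod (y + of_real r) - cmod x \<le> cmod (x + y + of_real r)"
        using norm_diff_ineq[of "y + of_real r" x] by (simp add: add_ac)
      moreover have "0 \<le> c / 2 * r" using c that by simp
      ultimately show ?thesis by (simp add: algebra_simps)
    qed
    have "cmod (x + y + of_real r) > 0" if "r \<ge> 0" for r
      using far[OF that] c elim that by (intro less_le_trans[OF _ far] mult_pos_pos) auto
    \<comment> \<open>For x + y on the nonpositive real axis this r would be nonnegative and x + y +
      r would vanish.\<close>
    from this[of "- Re (x + y)"] have "x + y \<notin> \<real>\<^sub>\<le>\<^sub>0"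
      by (auto simp: complex_nonpos_Reals_iff complex_eq_iff)
    moreover have "cmod (binet (x + y)) \<le> 11 / (c / 2)\<^sup>2 * cmod y powr (- 1 / 2) * (\<Sum>n. real (Suc n) powr (- 3 / 2))"
      using elim c far[of "of_nat _"] by (intro binet_bound(2)) (auto simp: field_simps)
    ultimately show ?case by (simp add: K_def mult_ac)
  qed
  then show "\<forall>\<^sub>F y in ?F. x + y \<notin> \<real>\<^sub>\<le>\<^sub>0" by (rule eventually_mono) simp
  have "((\<lambda>y. cmod y powr (- 1 / 2)) \<longlongrightarrow> 0) ?F"
    by (rule tendsto_neg_powr[OF _ inf]) simp
  then have "((\<lambda>y. K * cmod y powr (- 1 / 2)) \<longlongrightarrow> 0) ?F" by (rule tendsto_mult_right_zero)
  then show "((\<lambda>y. binet (x + y)) \<longlongrightarrow> 0) ?F"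
    by (rule Lim_null_comparison[rotated]) (use ev in \<open>auto elim: eventually_mono\<close>)
qed

text \<open>
  Written with \<open>rGamma\<close>, so that the value at a pole of \<open>Lambda x\<close> is the genuine zero of
  the reciprocal and not a junk value.
\<close>

definition inverse_Lambda :: "complex \<Rightarrow> complex \<Rightarrow> complex" where
  "inverse_Lambda x y = rGamma (x + y) * exp ((x + y - 1 / 2) * Ln y - y) * of_real (sqrt (2 * pi))"

section \<open>The reciprocal of Lambda and its reflection formula\<close>

text \<open>At a pole of Gamma both sides are the default 0. The point y = 0 is excluded because
  \<open>0 powr a\<close> is 0, whereas \<open>exp (a * Ln 0)\<close> is not.\<close>

lemma Lambda_eq_inverse:
  assumes "y \<noteq> 0"
  shows "Lambda x y = inverse (inverse_Lambda x y)"
proof -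
  define u where "u = (x + y - 1 / 2) * Ln y"
  show ?thesis
    unfolding Lambda_def inverse_Lambda_def rGamma_inverse_Gamma powr_def u_def[symmetric] exp_diff
    using assms by (simp add: divide_inverse)
qed

text \<open>With w = x + y the exponents w - 1/2 and 1 - w - 1/2 are opposite, so only Ln y - Ln (-
  y) remains. Setting e = exp (i pi w), the factor 2 sin (pi w) is i (1 / e - e), and the power is e
  / i above and i / e below the real axis.\<close>

lemma inverse_Lambda_reflection:
  assumes "y \<noteq> 0"
  shows "Im y > 0 \<Longrightarrow> inverse_Lambda x y * inverse_Lambda (1 - x) (- y) = 1 - exp (2 * pi * \<i> * (x + y))"
    and "Im y < 0 \<Longrightarrow> inverse_Lambda x y * inverse_Lambda (1 - x) (- y) = 1 - exp (- (2 * pi * \<i> * (x + y)))"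
proof -
  define w where "w = x + y"
  define e where "e = exp (\<i> * of_real pi * w)"
  have "e \<noteq> 0" by (simp add: e_def)
  have ee: "exp (2 * pi * \<i> * (x + y)) = e * e"
    by (simp add: e_def w_def algebra_simps flip: exp_add)
  have half: "exp (\<i> * of_real (pi / 2)) = \<i>"
    by (simp only: cis_conv_exp[symmetric] cis_pi_half)
  have "complex_of_real (sqrt (2 * pi)) * of_real (sqrt (2 * pi)) = of_real (sqrt (2 * pi) * sqrt (2 * pi))"
    by (simp only: of_real_mult)
  then have sq: "complex_of_real (sqrt (2 * pi)) * of_real (sqrt (2 * pi)) = 2 * of_real pi"
    by simp
  have one_minus: "1 - x + - y = 1 - w" by (simp add: w_def)
  have "exp ((w - 1/2) * Ln y - y) * exp ((1 - w - 1/2) * Ln (- y) - (- y)) =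
       exp ((w - 1/2) * (Ln y - Ln (- y)))"
    unfolding exp_add[symmetric] by (rule arg_cong[of _ _ exp]) (simp add: algebra_simps)
  then have "inverse_Lambda x y * inverse_Lambda (1 - x) (- y) =
    (rGamma w * rGamma (1 - w)) * exp ((w - 1/2) * (Ln y - Ln (- y))) *
      (of_real (sqrt (2 * pi)) * of_real (sqrt (2 * pi)))"
    unfolding inverse_Lambda_def one_minus w_def[symmetric] by (simp only: mult_ac)
  also have "\<dots> = 2 * sin (of_real pi * w) * exp ((w - 1/2) * (Ln y - Ln (- y)))"
    unfolding sq rGamma_reflection_complex by simp
  also have "2 * sin (of_real pi * w) = \<i> * (inverse e - e)"
    by (simp add: sin_exp_eq e_def exp_minus mult.assoc)
       (simp add: algebra_simps)
  finally have *: "inverse_Lambda x y * inverse_Lambda (1 - x) (- y) =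
      \<i> * (inverse e - e) * exp ((w - 1/2) * (Ln y - Ln (- y)))" .
  show "inverse_Lambda x y * inverse_Lambda (1 - x) (- y) = 1 - exp (2 * pi * \<i> * (x + y))" if "Im y > 0"
  proof -
    have d: "Ln y - Ln (- y) = \<i> * of_real pi" using that assms by (simp add: Ln_minus)
    have "exp ((w - 1/2) * (Ln y - Ln (- y))) = exp (\<i> * of_real pi * w - \<i> * of_real (pi / 2))"
      unfolding d by (simp add: algebra_simps)
    also have "\<dots> = e / \<i>"
      unfolding exp_diff half e_def ..
    finally show ?thesis unfolding * ee using \<open>e \<noteq> 0\<close> by (simp add: field_simps)
  qed
  show "inverse_Lambda x y * inverse_Lambda (1 - x) (- y) = 1 - exp (- (2 * pi * \<i> * (x + y)))" if "Im y < 0"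
  proof -
    have d: "Ln y - Ln (- y) = - (\<i> * of_real pi)" using that assms by (simp add: Ln_minus)
    have "exp ((w - 1/2) * (Ln y - Ln (- y))) = exp (\<i> * of_real (pi / 2) - \<i> * of_real pi * w)"
      unfolding d by (simp add: algebra_simps)
    also have "\<dots> = \<i> / e"
      unfolding exp_diff half e_def ..
    finally show ?thesis unfolding * exp_minus ee using \<open>e \<noteq> 0\<close> by (simp add: field_simps)
  qed
qed

section \<open>The limit of Lambda in sectors\<close>

text \<open>Inserting the formula for \<open>exp (binet (x + y))\<close> writes
  \<open>Lambda x y\<close> as K times an exponential whose exponent tends to 0. That K does not
  depend on x or \<delta> allows it to be computed from a special case.\<close>

lemma Lambda_tendsto_const:
  obtains K :: real where "K > 0"
    "\<And>x \<delta>. 0 < \<delta> \<Longrightarrow> \<delta> < pi \<Longrightarrow> (Lambda x \<longlongrightarrow> of_real K) (sector_at_infinity \<delta>)"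
proof -
  obtain C :: real where "C > 0" and
    C: "\<And>z. z \<notin> \<real>\<^sub>\<le>\<^sub>0 \<Longrightarrow> exp (binet z) = of_real C * Gamma z * exp (z - (z - 1 / 2) * Ln z)"
    by (rule exp_binet_eq_Gamma) blast
  define K where "K = 1 / (C * sqrt (2 * pi))"
  have "(Lambda x \<longlongrightarrow> of_real K) (sector_at_infinity \<delta>)" if \<delta>: "0 < \<delta>" "\<delta> < pi" for x \<delta>
  proof -
    let ?F = "sector_at_infinity \<delta>"
    have "((\<lambda>y. of_real K * exp (binet (x + y) + (x + y - 1 / 2) * (Ln (x + y) - Ln y) - x))
        \<longlongrightarrow> of_real K * exp (0 + x - x)) ?F"
      by (intro tendsto_mult tendsto_const tendsto_exp tendsto_diff tendsto_add binet_shift_tendsto_0(1)[OF \<delta>]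
            tendsto_shifted_power_exponent[OF inf_le1] eventually_Ln_shift_sector[OF \<delta>(1)])
    moreover have "\<forall>\<^sub>F y in ?F. y \<in> closed_subsector (- 1) \<delta>"
      by (simp add: eventually_inf_principal)
    with binet_shift_tendsto_0(2)[OF \<delta>, of x]
    have "\<forall>\<^sub>F y in ?F. of_real K * exp (binet (x + y) + (x + y - 1 / 2) * (Ln (x + y) - Ln y) - x) = Lambda x y"
    proof eventually_elim
      case (elim y)
      define u where "u = (x + y - 1 / 2) * Ln y"
      define v where "v = (x + y - 1 / 2) * Ln (x + y)"
      have B: "exp (binet (x + y)) = of_real C * Gamma (x + y) * exp (x + y - v)"
        unfolding v_def by (rule C[OF elim(1)])
      have "binet (x + y) + (x + y - 1 / 2) * (Ln (x + y) - Ln y) - x = binet (x + y) + ((v - u) - x)"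
        by (simp add: u_def v_def algebra_simps)
      then have "exp (binet (x + y) + (x + y - 1 / 2) * (Ln (x + y) - Ln y) - x) =
          of_real C * Gamma (x + y) * (exp (x + y - v) * exp ((v - u) - x))"
        by (simp only: exp_add[of "binet (x + y)"] B mult.assoc)
      also have "exp (x + y - v) * exp ((v - u) - x) = exp y / exp u"
        unfolding exp_add[symmetric] exp_diff[symmetric] by (rule arg_cong[of _ _ exp]) simp
      finally have "exp (binet (x + y) + (x + y - 1 / 2) * (Ln (x + y) - Ln y) - x) =
          of_real C * Gamma (x + y) * (exp y / exp u)" .
      moreover have "y \<noteq> 0" using elim(2) by (simp add: closed_subsector_iff)
      ultimately show ?case using \<open>C > 0\<close>
        unfolding Lambda_def powr_def u_def[symmetric] by (simp add: K_def)
    qed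
    ultimately have "(Lambda x \<longlongrightarrow> of_real K * exp (0 + x - x)) ?F"
      by (rule Lim_transform_eventually)
    then show ?thesis by simp
  qed
  with \<open>C > 0\<close> show ?thesis by (intro that[of K]) (auto simp: K_def)
qed

lemma Lambda_tendsto_1:
  assumes "0 < \<delta>" "\<delta> < pi"
  shows "(Lambda x \<longlongrightarrow> 1) (sector_at_infinity \<delta>)"
proof -
  obtain K :: real where "K > 0" and
    K: "\<And>x \<delta>. 0 < \<delta> \<Longrightarrow> \<delta> < pi \<Longrightarrow> (Lambda x \<longlongrightarrow> of_real K) (sector_at_infinity \<delta>)"
    by (rule Lambda_tendsto_const) blast
  \<comment> \<open>The points i (n + 1) and their negatives both lie in the sector with \<delta> =
    pi / 2, so \<open>Lambda 0\<close> and \<open>Lambda 1\<close> both tend to K along them;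
    \<open>Suc n\<close> avoids y = 0. Reflection turns their product into 1 / (1 - exp (- 2 pi (n +
    1))), which tends to 1.\<close>
  define y where "y = (\<lambda>n::nat. \<i> * of_nat (Suc n))"
  have y_nz: "y n \<noteq> 0" for n by (simp add: y_def del: of_nat_Suc)
  have filt: "filterlim (\<lambda>n. s * y n) (sector_at_infinity (pi / 2)) sequentially" if "s = 1 \<or> s = - 1" for s :: complex
  proof -
    have "s * y n \<in> closed_subsector (- 1) (pi / 2)" for n
    proof -
      have "Re (s * y n) = 0" and nz: "s * y n \<noteq> 0"
        using that y_nz[of n] by (auto simp: y_def)
      then have "\<bar>Im (Ln (s * y n))\<bar> \<le> pi / 2" by (subst Re_Ln_pos_le) auto
      then show ?thesis unfolding closed_subsector_iff Arg_eq_Im_Ln[OF nz] using nz by linarith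
    qed
    moreover have "filterlim (\<lambda>n. s * y n) at_infinity sequentially"
    proof (rule filterlim_norm_at_top_imp_at_infinity)
      have "(\<lambda>n. cmod (s * y n)) = (\<lambda>n. real (Suc n))"
        using that unfolding y_def norm_mult norm_of_nat by auto
      then show "filterlim (\<lambda>n. cmod (s * y n)) at_top sequentially"
        by (simp only: filterlim_sequentially_Suc filterlim_real_sequentially)
    qed
    ultimately show ?thesis by (simp add: filterlim_inf filterlim_principal)
  qed
  have "(\<lambda>n. Lambda 0 (1 * y n) * Lambda 1 (- 1 * y n)) \<longlonglongrightarrow> of_real K * of_real K"
    by (intro tendsto_mult filterlim_compose[OF K filt]) auto
  moreover have "(\<lambda>n. Lambda 0 (1 * y n) * Lambda 1 (- 1 * y n)) = (\<lambda>n. inverse (1 - of_real (exp (- 2 * pi) ^ Suc n)))"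
  proof
    fix n
    have "Lambda 0 (1 * y n) * Lambda 1 (- 1 * y n) = inverse (inverse_Lambda 0 (y n) * inverse_Lambda (1 - 0) (- y n))"
      using y_nz[of n] by (simp add: Lambda_eq_inverse)
    also have "inverse_Lambda 0 (y n) * inverse_Lambda (1 - 0) (- y n) = 1 - exp (2 * pi * \<i> * (0 + y n))"
      by (rule inverse_Lambda_reflection[OF y_nz]) (simp add: y_def)
    also have "2 * pi * \<i> * (0 + y n) = of_real (Suc n * (- 2 * pi))"
      by (simp add: y_def algebra_simps)
    also have "exp \<dots> = of_real (exp (- 2 * pi) ^ Suc n)"
      unfolding exp_of_real exp_of_nat_mult ..
    finally show "Lambda 0 (1 * y n) * Lambda 1 (- 1 * y n) = inverse (1 - of_real (exp (- 2 * pi) ^ Suc n))" .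
  qed
  moreover have "(\<lambda>n. exp (- 2 * pi) ^ Suc n) \<longlonglongrightarrow> 0"
    by (rule LIMSEQ_Suc[OF LIMSEQ_power_zero]) simp
  then have "(\<lambda>n. inverse (1 - complex_of_real (exp (- 2 * pi) ^ Suc n))) \<longlonglongrightarrow> inverse (1 - of_real 0)"
    by (intro tendsto_intros) auto
  ultimately have "complex_of_real K * of_real K = inverse (1 - of_real 0)"
    by (simp only: LIMSEQ_unique)
  then have "complex_of_real K * of_real K = 1" by simp
  then have "K * K = 1" by (metis of_real_1 of_real_eq_iff of_real_mult)
  then have "K = 1" using \<open>K > 0\<close> by (simp add: square_eq_1_iff)
  then show ?thesis using K[OF assms, of x] by simp
qed

section \<open>The Riemann-Hilbert problem\<close>

lemma inverse_Lambda_eq_0_iff: "inverse_Lambda x y = 0 \<longleftrightarrow> x + y \<in> \<int>\<^sub>\<le>\<^sub>0"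
  by (simp add: inverse_Lambda_def rGamma_eq_zero_iff)

lemma analytic_inverse_Lambda:
  assumes "t \<noteq> 0" "c / t \<notin> \<real>\<^sub>\<le>\<^sub>0"
  shows "(\<lambda>t. inverse_Lambda x (c / t)) analytic_on {t}"
  unfolding inverse_Lambda_def using assms by (auto intro!: analytic_intros)

lemma eventually_Lambda_eq_inverse:
  assumes "t \<noteq> 0" "c \<noteq> 0"
  shows "\<forall>\<^sub>F s in nhds t. Lambda x (c / s) = inverse (inverse_Lambda x (c / s))"
  using t1_space_nhds[OF \<open>t \<noteq> 0\<close>]
  by eventually_elim (use assms in \<open>simp add: Lambda_eq_inverse\<close>)

lemma analytic_Lambda:
  assumes "t \<noteq> 0" "c / t \<notin> \<real>\<^sub>\<le>\<^sub>0" "x + c / t \<notin> \<int>\<^sub>\<le>\<^sub>0"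
  shows "(\<lambda>t. Lambda x (c / t)) analytic_on {t}"
proof -
  have "c \<noteq> 0" using assms by auto
  have "(\<lambda>t. inverse (inverse_Lambda x (c / t))) analytic_on {t}"
    using assms by (intro analytic_intros analytic_inverse_Lambda) (auto simp: inverse_Lambda_eq_0_iff)
  then show ?thesis
    using analytic_at_cong[OF eventually_Lambda_eq_inverse[OF \<open>t \<noteq> 0\<close> \<open>c \<noteq> 0\<close>] refl] by blast
qed

text \<open>The reciprocal is continuous and vanishes at t, and its zero there is isolated: at
  another zero s the numbers c / s and c / t would differ by an integer, which is 0 once they are at
  distance less than 1.\<close>

lemma is_pole_Lambda:
  assumes "t \<noteq> 0" "c / t \<notin> \<real>\<^sub>\<le>\<^sub>0" "x + c / t \<in> \<int>\<^sub>\<le>\<^sub>0"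
  shows "is_pole (\<lambda>t. Lambda x (c / t)) t"
proof -
  let ?g = "\<lambda>t. inverse_Lambda x (c / t)"
  have "c \<noteq> 0" using assms by auto
  have "?g \<midarrow>t\<rightarrow> ?g t"
    using analytic_at_imp_isCont[OF analytic_inverse_Lambda[OF assms(1,2)]] by (simp add: isCont_def)
  then have g: "?g \<midarrow>t\<rightarrow> 0" using assms inverse_Lambda_eq_0_iff by metis
  have "((\<lambda>s. c / s) \<longlongrightarrow> c / t) (at t)" using assms by (intro tendsto_intros)
  then have "\<forall>\<^sub>F s in at t. dist (c / s) (c / t) < 1" by (rule tendstoD) simp
  moreover have "\<forall>\<^sub>F s in at t. s \<noteq> t" by (simp add: eventually_at_filter)
  ultimately have "\<forall>\<^sub>F s in at t. ?g s \<noteq> 0"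
  proof eventually_elim
    case (elim s)
    show ?case
    proof
      assume "?g s = 0"
      then have s: "x + c / s \<in> \<int>" and t: "x + c / t \<in> \<int>"
        using assms(3) by (auto simp: inverse_Lambda_eq_0_iff dest: nonpos_Ints_Int)
      obtain k where k: "(x + c / s) - (x + c / t) = of_int k"
        using Ints_diff[OF s t] by (auto elim: Ints_cases)
      then have "c / s - c / t = of_int k" by (simp add: algebra_simps)
      then have "\<bar>real_of_int k\<bar> < 1"
        using elim(1) by (simp add: dist_norm)
      then have "k = 0" by linarith
      then have "c / s = c / t" using k by simp
      then show False using elim(2) \<open>c \<noteq> 0\<close> \<open>t \<noteq> 0\<close> by (cases "s = 0") (auto simp: field_simps)
    qed
  qed
  with g have "filterlim ?g (at 0) (at t)" by (auto simp: filterlim_at)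
  then have "is_pole (\<lambda>s. inverse (?g s)) t"
    unfolding is_pole_def by (rule filterlim_compose[OF filterlim_inverse_at_infinity])
  moreover have "\<forall>\<^sub>F s in at t. Lambda x (c / s) = inverse (?g s)"
    using eventually_Lambda_eq_inverse[OF \<open>t \<noteq> 0\<close> \<open>c \<noteq> 0\<close>, of x]
    by (auto simp: eventually_at_filter elim: eventually_mono)
  ultimately show ?thesis by (simp only: is_pole_cong[OF _ refl])
qed

lemma nicely_meromorphic_Lambda:
  assumes "\<And>t. t \<in> D \<Longrightarrow> t \<noteq> 0 \<and> c / t \<notin> \<real>\<^sub>\<le>\<^sub>0"
  shows "(\<lambda>t. Lambda x (c / t)) nicely_meromorphic_on D"
  unfolding nicely_meromorphic_on_def
proof (intro conjI ballI)
  let ?f = "\<lambda>t. Lambda x (c / t)"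
  have nz: "c \<noteq> 0" if "t \<in> D" for t using assms[OF that] by auto
  have ev: "\<forall>\<^sub>F s in at t. inverse (inverse_Lambda x (c / s)) = ?f s" if t: "t \<in> D" for t
    using eventually_Lambda_eq_inverse[of t c x] assms[OF t] nz[OF t]
    by (auto simp: eventually_at_filter elim: eventually_mono)
  have "(\<lambda>t. inverse_Lambda x (c / t)) analytic_on D"
    using assms analytic_inverse_Lambda analytic_on_analytic_at by blast
  then have "(\<lambda>t. inverse (inverse_Lambda x (c / t))) meromorphic_on D"
    by (intro meromorphic_intros analytic_on_imp_meromorphic_on)
  then show "?f meromorphic_on D"
    using meromorphic_on_cong[OF ev refl] by blast
  fix t assume t: "t \<in> D"
  show "is_pole ?f t \<and> ?f t = 0 \<or> ?f \<midarrow>t\<rightarrow> ?f t"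
  proof (cases "x + c / t \<in> \<int>\<^sub>\<le>\<^sub>0")
    case True
    \<comment> \<open>The default value 0 of \<open>Gamma\<close> at its poles is the value that
      \<open>nicely_meromorphic_on\<close> prescribes.\<close>
    then have "?f t = 0" by (simp add: Lambda_def Gamma_eq_zero_iff)
    then show ?thesis using is_pole_Lambda assms[OF t] True by blast
  next
    case False
    then show ?thesis
      using analytic_at_imp_isCont[OF analytic_Lambda] assms[OF t] by (blast dest: isContD)
  qed
qed

text \<open>As \<open>c\<close> is a positive multiple of \<open>- v\<close> and inversion preserves
  |Arg|, the map t to c / t carries the subsector off the slit \<open>v\<close> into the sector off
  the negative reals with the same \<delta>.\<close>

lemma tendsto_Lambda_at_0:
  assumes c: "c = - v * of_real r" and "r > 0" "v \<noteq> 0" and \<delta>: "0 < \<delta>" "\<delta> < pi"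
  shows "((\<lambda>t. Lambda x (c / t)) \<longlongrightarrow> 1) (at 0 within closed_subsector v \<delta>)"
proof -
  have "c \<noteq> 0" using assms by simp
  have "c / t \<in> closed_subsector (- 1) \<delta>" if "t \<in> closed_subsector v \<delta>" for t
  proof -
    define s where "s = t / (- v)"
    have "t \<noteq> 0" and s: "\<bar>Arg s\<bar> \<le> pi - \<delta>" using that by (auto simp: closed_subsector_def s_def)
    have "c / t = of_real r * inverse s" using \<open>v \<noteq> 0\<close> \<open>t \<noteq> 0\<close> by (simp add: c s_def field_simps)
    then have "Arg (c / t) = Arg (inverse s)" using \<open>r > 0\<close> by (simp only: Arg_times_of_real)
    then have "\<bar>Arg (c / t)\<bar> \<le> pi - \<delta>" using s by (simp add: Arg_inverse)
    then show ?thesis using \<open>c \<noteq> 0\<close> \<open>t \<noteq> 0\<close> by (simp add: closed_subsector_iff)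
  qed
  then have "\<forall>\<^sub>F t in at 0 within closed_subsector v \<delta>. c / t \<in> closed_subsector (- 1) \<delta>"
    by (auto simp: eventually_at_filter)
  moreover have "filterlim (\<lambda>t. c / t) at_infinity (at 0 within closed_subsector v \<delta>)"
    by (rule filterlim_divide_at_infinity[OF tendsto_const _ \<open>c \<noteq> 0\<close>])
       (auto simp: filterlim_at eventually_at_filter)
  ultimately have "filterlim (\<lambda>t. c / t) (sector_at_infinity \<delta>) (at 0 within closed_subsector v \<delta>)"
    by (simp add: filterlim_inf filterlim_principal)
  then show ?thesis by (rule filterlim_compose[OF Lambda_tendsto_1[OF \<delta>]])
qed

section \<open>Growth at infinity, from the behaviour of Lambda at 0\<close>

text \<open>Re (a Ln y) is Re a ln |y| - Im a Im (Ln y); here ln |y| <= 0, and |Im (Ln y)| <= pi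
  bounds the effect of the branch.\<close>

lemma norm_exp_mult_Ln_le:
  fixes m :: nat
  assumes "y \<noteq> 0" "cmod y \<le> 1" "cmod a \<le> m"
  shows "cmod (exp (a * Ln y)) \<le> exp (m * pi) * cmod (1 / y ^ m)"
proof -
  have ln: "ln (cmod y) \<le> 0" using assms by simp
  have "Re (a * Ln y) = Re a * ln (cmod y) - Im a * Im (Ln y)"
    using assms(1) by simp
  moreover have "Re a * ln (cmod y) \<le> - real m * ln (cmod y)"
    using ln assms(3) abs_Re_le_cmod[of a] by (intro mult_right_mono_neg) auto
  moreover have "- (Im a * Im (Ln y)) \<le> \<bar>Im a\<bar> * \<bar>Im (Ln y)\<bar>"
    by (simp add: abs_mult[symmetric])
  moreover have "\<bar>Im a\<bar> * \<bar>Im (Ln y)\<bar> \<le> m * pi"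
    using assms(1,3) abs_Im_le_cmod[of a] Im_Ln_le_pi[of y] mpi_less_Im_Ln[of y] by (intro mult_mono) auto
  ultimately have "Re (a * Ln y) \<le> m * pi - m * ln (cmod y)" by linarith
  then have "cmod (exp (a * Ln y)) \<le> exp (m * pi - m * ln (cmod y))" by simp
  also have "\<dots> = exp (m * pi) * cmod (1 / y ^ m)"
    using assms(1) by (simp add: exp_diff exp_of_nat_mult norm_divide norm_power)
  finally show ?thesis .
qed

text \<open>The sign \<open>e\<close> covers both the power in Lambda and the one in its reciprocal;
  the 1 added to |x| absorbs |y| < 1.\<close>

lemma bigo_exp_mult_Ln:
  assumes "cmod x + 1 \<le> real m" "e = 1 \<or> e = (-1 :: complex)"
  shows "(\<lambda>y. exp (e * (x + y) * Ln y)) \<in> O[at 0](\<lambda>y. 1 / y ^ m)"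
proof (rule bigoI)
  have "\<forall>\<^sub>F y in at (0::complex). cmod y < 1"
    unfolding eventually_at by (intro exI[of _ 1]) (simp add: dist_norm)
  moreover have "\<forall>\<^sub>F y in at (0::complex). y \<noteq> 0" by (simp add: eventually_at_filter)
  ultimately show "\<forall>\<^sub>F y in at 0. norm (exp (e * (x + y) * Ln y)) \<le> exp (m * pi) * norm (1 / y ^ m)"
  proof eventually_elim
    case (elim y)
    have "cmod (e * (x + y)) \<le> m"
      using assms elim norm_triangle_ineq[of x y] by (auto simp: norm_mult)
    then show ?case using elim by (intro norm_exp_mult_Ln_le) auto
  qed
qed

lemma tendsto_imp_bigo_1:
  fixes f :: "'a \<Rightarrow> complex"
  assumes "(f \<longlongrightarrow> L) F"
  shows "f \<in> O[F](\<lambda>_. 1 :: complex)"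
proof (rule bigoI)
  show "\<forall>\<^sub>F y in F. norm (f y) \<le> (norm L + 1) * norm (1 :: complex)"
    using order_tendstoD(2)[OF tendsto_norm[OF assms] less_add_one]
    by (rule eventually_mono) simp
qed

text \<open>Gamma(x + y) y has a limit at y = 0: the residue (-1)^n / n! if x = - n, and 0 if x is
  not a pole.\<close>

lemma bigo_Gamma_shift: "(\<lambda>y. Gamma (x + y)) \<in> O[at 0](\<lambda>y. 1 / y)" for x :: complex
proof -
  have "\<exists>L. ((\<lambda>y. Gamma (x + y) * y) \<longlongrightarrow> L) (at 0)"
  proof (cases "x \<in> \<int>\<^sub>\<le>\<^sub>0")
    case True
    then obtain n where x: "x = - of_nat n" by (elim nonpos_Ints_cases')
    have "x + h + of_nat n = h" for h by (simp add: x)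
    then have "(\<lambda>h. Gamma (x + h) * h) \<midarrow>0\<rightarrow> (- 1) ^ n / fact n"
      using LIM_offset_zero[OF Gamma_residues[of n, where 'a = complex]] unfolding x[symmetric] by (simp only:)
    then show ?thesis ..
  next
    case False
    have "((\<lambda>y. Gamma (x + y) * y) \<longlongrightarrow> Gamma (x + 0) * 0) (at 0)"
      using False by (intro tendsto_intros) auto
    then show ?thesis by blast
  qed
  then have "(\<lambda>y. Gamma (x + y) * y) \<in> O[at 0](\<lambda>_. 1 :: complex)"
    using tendsto_imp_bigo_1 by blast
  then have *: "(\<lambda>y. Gamma (x + y) * y * (1 / y)) \<in> O[at 0](\<lambda>y. 1 * (1 / y))"
    by (rule landau_o.big.mult) (rule landau_o.big_refl)
  have "\<forall>\<^sub>F y in at 0. Gamma (x + y) * y * (1 / y) = Gamma (x + y)"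
    by (simp add: eventually_at_filter)
  from landau_o.big.in_cong[OF this] * show ?thesis by (simp only: mult_1_left)
qed

lemma bigo_Lambda: "\<exists>m. Lambda x \<in> O[at 0](\<lambda>y. 1 / y ^ m)"
proof -
  obtain m where m: "cmod (x - 1 / 2) + 1 \<le> real m" using real_arch_simple by blast
  have "((\<lambda>y. 1 / of_real (sqrt (2 * pi)) * exp y) \<longlongrightarrow> 1 / of_real (sqrt (2 * pi)) * exp (0 :: complex)) (at 0)"
    by (intro isContD continuous_intros)
  note bound = this[THEN tendsto_imp_bigo_1]
  have "(\<lambda>y. exp (- 1 * (x - 1 / 2 + y) * Ln y)) \<in> O[at 0](\<lambda>y. 1 / y ^ m)"
    by (rule bigo_exp_mult_Ln[OF m]) simp
  from landau_o.big.mult[OF landau_o.big.mult[OF bigo_Gamma_shift[of x] this] bound]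
  have *: "(\<lambda>y. Gamma (x + y) * exp (- 1 * (x - 1 / 2 + y) * Ln y) * (1 / of_real (sqrt (2 * pi)) * exp y))
      \<in> O[at 0](\<lambda>y. 1 / y * (1 / y ^ m) * 1)" .
  have "Gamma (x + y) * exp (- 1 * (x - 1 / 2 + y) * Ln y) * (1 / of_real (sqrt (2 * pi)) * exp y)
      = Lambda x y" if "y \<noteq> 0" for y :: complex
  proof -
    define u where "u = (x + y - 1 / 2) * Ln y"
    have "- 1 * (x - 1 / 2 + y) * Ln y = - u" by (simp add: u_def algebra_simps)
    then have "Gamma (x + y) * exp (- 1 * (x - 1 / 2 + y) * Ln y) * (1 / of_real (sqrt (2 * pi)) * exp y)
        = Gamma (x + y) * inverse (exp u) * (1 / of_real (sqrt (2 * pi)) * exp y)"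
      by (simp only: exp_minus)
    also have "G * inverse E * (1 / r * F) = G * F / (E * r)" for G E F r :: complex
      by (simp add: field_simps)
    finally show ?thesis
      unfolding Lambda_def powr_def u_def[symmetric] using that by (simp only: if_False)
  qed
  moreover have "\<forall>\<^sub>F y in at (0 :: complex). y \<noteq> 0" by (simp add: eventually_at_filter)
  ultimately have "\<forall>\<^sub>F y in at 0. Gamma (x + y) * exp (- 1 * (x - 1 / 2 + y) * Ln y) * (1 / of_real (sqrt (2 * pi)) * exp y)
      = Lambda x y"
    by (rule eventually_mono[rotated])
  from landau_o.big.in_cong[OF this] * have "Lambda x \<in> O[at 0](\<lambda>y. 1 / y * (1 / y ^ m) * 1)"
    by blast
  \<comment> \<open>The possible pole of Gamma costs one power beyond \<open>m\<close>.\<close>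
  then have "Lambda x \<in> O[at 0](\<lambda>y. 1 / y ^ Suc m)"
    by (simp only: mult_1_right times_divide_times_eq power_Suc)
  then show ?thesis by blast
qed

lemma bigo_inverse_Lambda: "\<exists>m. inverse_Lambda x \<in> O[at 0](\<lambda>y. 1 / y ^ m)"
proof -
  obtain m where m: "cmod (x - 1 / 2) + 1 \<le> real m" using real_arch_simple by blast
  have "((\<lambda>y. rGamma (x + y) * exp (- y) * of_real (sqrt (2 * pi)))
      \<longlongrightarrow> rGamma (x + 0) * exp (- 0) * of_real (sqrt (2 * pi))) (at 0)"
    by (intro tendsto_mult tendsto_const tendsto_exp tendsto_minus tendsto_ident_at
          isContD[OF isCont_rGamma] continuous_intros)
  note bound = this[THEN tendsto_imp_bigo_1]
  have "(\<lambda>y. exp (1 * (x - 1 / 2 + y) * Ln y)) \<in> O[at 0](\<lambda>y. 1 / y ^ m)"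
    by (rule bigo_exp_mult_Ln[OF m]) simp
  from landau_o.big.mult[OF this bound]
  have "(\<lambda>y. exp (1 * (x - 1 / 2 + y) * Ln y) * (rGamma (x + y) * exp (- y) * of_real (sqrt (2 * pi))))
      \<in> O[at 0](\<lambda>y. 1 / y ^ m * 1)" .
  moreover have "exp (1 * (x - 1 / 2 + y) * Ln y) * (rGamma (x + y) * exp (- y) * of_real (sqrt (2 * pi)))
      = inverse_Lambda x y" for y
  proof -
    have "(x + y - 1 / 2) * Ln y - y = 1 * (x - 1 / 2 + y) * Ln y + - y" by (simp add: algebra_simps)
    then show ?thesis unfolding inverse_Lambda_def by (simp only: exp_add mult_ac)
  qed
  ultimately have "inverse_Lambda x \<in> O[at 0](\<lambda>y. 1 / y ^ m)" by (simp only: mult_1_right)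
  then show ?thesis by blast
qed

text \<open>Under y = c / t the bound 1 / y^m becomes a constant times t^m. It holds on a full
  neighbourhood of infinity and is then restricted to \<open>D\<close>.\<close>

lemma algebraic_growth_compose_divide:
  assumes "F \<in> O[at 0](\<lambda>y. 1 / y ^ m)" "c \<noteq> 0" "\<forall>\<^sub>F t in at_infinity. Y t = F (c / t)"
  shows "algebraic_growth D Y"
proof -
  have "((\<lambda>t. c / t) \<longlongrightarrow> 0) at_infinity"
    by (intro tendsto_divide_0[OF tendsto_const] filterlim_ident)
  moreover have "\<forall>\<^sub>F t in at_infinity. c / t \<noteq> 0"
    using eventually_not_equal_at_infinity[of 0] by eventually_elim (use assms in simp)
  ultimately have "filterlim (\<lambda>t. c / t) (at 0) at_infinity" by (auto simp: filterlim_at)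
  from landau_o.big.compose[OF assms(1) this]
  have "(\<lambda>t. F (c / t)) \<in> O[at_infinity](\<lambda>t. 1 / (c / t) ^ m)" .
  moreover have "1 / (c / t) ^ m = 1 / c ^ m * t ^ m" for t by (simp add: power_divide)
  ultimately have "(\<lambda>t. F (c / t)) \<in> O[at_infinity](\<lambda>t. 1 / c ^ m * t ^ m)"
    by (simp only:)
  moreover have "1 / c ^ m \<noteq> 0" using assms(2) by simp
  note landau_o.big.cmult[OF this, of at_infinity "\<lambda>t. t ^ m"]
  ultimately have "(\<lambda>t. F (c / t)) \<in> O[at_infinity](\<lambda>t. t ^ m)" by (simp only:)
  then have "Y \<in> O[at_infinity](\<lambda>t. t ^ m)"
    using landau_o.big.in_cong[OF assms(3)] by blast
  then have "Y \<in> O[inf at_infinity (principal D)](\<lambda>t. t ^ m)"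
    by (rule landau_o.big.filter_mono[rotated]) simp
  then show ?thesis unfolding algebraic_growth_def by blast
qed


section \<open>Slits, half-planes and the twisted torus\<close>

text \<open>If c / t = q <= 0 then q < 0, and t = v (- r / q) lies on the slit.\<close>

lemma slit_plane_divide_notin_nonpos_Reals:
  assumes "t \<in> slit_plane v" "c = - v * of_real r" "r > 0" "v \<noteq> 0"
  shows "t \<noteq> 0" "c / t \<notin> \<real>\<^sub>\<le>\<^sub>0"
proof -
  show "t \<noteq> 0" using assms by (simp add: slit_plane_def)
  have "c \<noteq> 0" using assms by simp
  show "c / t \<notin> \<real>\<^sub>\<le>\<^sub>0"
  proof
    assume "c / t \<in> \<real>\<^sub>\<le>\<^sub>0"
    then obtain q where q: "c / t = of_real q" "q \<le> 0" by (auto elim: nonpos_Reals_cases)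
    have "q \<noteq> 0" using q(1) \<open>c \<noteq> 0\<close> \<open>t \<noteq> 0\<close> by auto
    with q have "t = v * of_real (- r / q)" "- r / q > 0"
      using \<open>t \<noteq> 0\<close> assms by (auto simp: field_simps)
    then have "t \<in> ray v" unfolding ray_def by blast
    then show False using assms(1) by (simp add: slit_plane_def)
  qed
qed

lemma half_plane_ray_Re_pos:
  assumes "t \<in> half_plane (ray w)" "w \<noteq> 0"
  shows "t \<noteq> 0" "0 < Re (w / t)"
proof -
  obtain s u where t: "t = w * of_real s * u" and "s > 0" "u \<noteq> 0"
    and u: "- pi / 2 < Arg u" "Arg u < pi / 2"
    using assms(1) by (auto simp: half_plane_def ray_def)
  show "t \<noteq> 0" using t \<open>s > 0\<close> \<open>u \<noteq> 0\<close> assms(2) by simp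
  have "Re u = cmod u * cos (Arg u)" by (metis Re_rcis rcis_cmod_Arg)
  moreover have "cos (Arg u) > 0" using u by (intro cos_gt_zero_pi) auto
  ultimately have "Re u > 0" using \<open>u \<noteq> 0\<close> by simp
  have "w / t = inverse u / of_real s"
    using t \<open>s > 0\<close> \<open>u \<noteq> 0\<close> assms(2) by (simp add: field_simps)
  then have "Re (w / t) = Re (inverse u) / s" by simp
  moreover have "(Re u)\<^sup>2 + (Im u)\<^sup>2 > 0" using \<open>Re u > 0\<close> by (simp add: sum_power2_gt_zero_iff)
  then have "Re (inverse u) > 0"
    unfolding inverse_complex.sel using \<open>Re u > 0\<close> by (rule divide_pos_pos[rotated])
  ultimately show "0 < Re (w / t)" using \<open>s > 0\<close> by (simp only: divide_pos_pos)
qed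

lemma exp_Ln2pi:
  assumes "w \<noteq> 0"
  shows "exp (Ln2pi w) = w"
proof -
  have "exp (Ln2pi w) = of_real (cmod w) * exp (\<i> * of_real (Arg2pi w))"
    using assms exp_eq_polar[of "Ln2pi w"] by (simp add: Ln2pi_def flip: cis_conv_exp)
  also have "\<dots> = w" by (rule Arg2pi_eq[symmetric])
  finally show ?thesis .
qed

text \<open>The pairing of \<open>alpha\<close> with \<open>- alpha\<close> is 0, so no sign
  enters.\<close>

lemma twisted_torus_uminus_alpha:
  assumes "\<xi> \<in> twisted_torus"
  shows "\<xi> (- alpha) = inverse (\<xi> alpha)"
proof -
  have mult: "\<xi> (g + h) = (-1) powi pairing g h * \<xi> g * \<xi> h" and nz: "\<xi> g \<noteq> 0" for g h
    using assms unfolding twisted_torus_def by blast+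
  have "\<xi> 0 = 1" using mult[of 0 0] nz[of 0] by (simp add: zero_prod_def)
  moreover have "\<xi> (alpha + - alpha) = \<xi> alpha * \<xi> (- alpha)"
    unfolding mult by (simp add: alpha_def)
  ultimately show ?thesis using nz[of alpha] by (simp add: field_simps)
qed

theorem proposition4p3:
  fixes Z :: "lattice \<Rightarrow> complex" and Om :: "lattice \<Rightarrow> int"
    and \<xi> :: "lattice \<Rightarrow> complex" and z \<theta> :: complex
    and Y_minus Y_plus :: "complex \<Rightarrow> complex"
  assumes "doubled_A1 Z Om"
    and "\<xi> \<in> twisted_torus"
    and "z = Z alpha"
    and "\<theta> = Ln2pi (\<xi> alpha)"
    and "Y_minus = (\<lambda>t. Lambda (\<theta> / (2 * pi * \<i>)) (- (z / (2 * pi * \<i> * t))))"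
    and "Y_plus = (\<lambda>t. inverse (Lambda (1 - \<theta> / (2 * pi * \<i>)) (z / (2 * pi * \<i> * t))))"
  shows "solves_RH_problem Z \<xi> Y_plus Y_minus"
proof -
  define x where "x = \<theta> / (2 * pi * \<i>)"
  \<comment> \<open>This is - z / (2 pi i), a positive multiple of i z: it points away from the slit
    of \<open>Y_minus\<close>, and \<open>- c\<close> points away from that of
    \<open>Y_plus\<close>.\<close>
  define c where "c = \<i> * z * of_real (1 / (2 * pi))"
  let ?Dp = "slit_plane (\<i> * z)" and ?Dm = "slit_plane (- \<i> * z)" and ?S = "exceptional_points z \<theta>"
  have "z \<noteq> 0" using assms(1,3) by (simp add: doubled_A1_def)
  then have "c \<noteq> 0" by (simp add: c_def)
  have exp_\<theta>: "exp \<theta> = \<xi> alpha"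
    using assms(2) unfolding assms(4) twisted_torus_def by (intro exp_Ln2pi) blast
  have "- (z / (2 * pi * \<i> * t)) = c / t" for t
    by (simp add: c_def divide_simps)
  then have Ym: "Y_minus = (\<lambda>t. Lambda x (c / t))"
    by (simp only: assms(5) x_def)
  have "z / (2 * pi * \<i> * t) = - c / t" for t
    by (simp add: c_def divide_simps)
  then have Yp: "Y_plus = (\<lambda>t. inverse (Lambda (1 - x) (- c / t)))"
    by (simp only: assms(6) x_def)
  have Yp': "Y_plus t = inverse_Lambda (1 - x) (- c / t)" if "t \<noteq> 0" for t
    using that \<open>c \<noteq> 0\<close> by (simp add: Yp Lambda_eq_inverse)
  have twopi_x: "2 * pi * \<i> * (x + c / t) = \<theta> - z / t" for t
    by (simp add: x_def c_def algebra_simps)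

  have Dm: "t \<noteq> 0" "c / t \<notin> \<real>\<^sub>\<le>\<^sub>0" if "t \<in> ?Dm" for t
    using slit_plane_divide_notin_nonpos_Reals[OF that, of c "1 / (2 * pi)"] \<open>z \<noteq> 0\<close> by (auto simp: c_def)
  have Dp: "t \<noteq> 0" "- c / t \<notin> \<real>\<^sub>\<le>\<^sub>0" if "t \<in> ?Dp" for t
    using slit_plane_divide_notin_nonpos_Reals[OF that, of "- c" "1 / (2 * pi)"] \<open>z \<noteq> 0\<close> by (auto simp: c_def)

  \<comment> \<open>By \<open>twopi_x\<close>, x + c / t = - n means z / t = \<theta> + 2 pi i n:
    the possible poles of \<open>Y_minus\<close>.\<close>
  have Sm: "x + c / t \<notin> \<int>\<^sub>\<le>\<^sub>0" if "t \<noteq> 0" "t \<notin> ?S" for t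
  proof
    assume "x + c / t \<in> \<int>\<^sub>\<le>\<^sub>0"
    then obtain n where n: "x + c / t = - of_nat n" by (elim nonpos_Ints_cases')
    have "z / t = \<theta> + 2 * of_nat n * pi * \<i>"
      using twopi_x[of t] unfolding n by (simp add: algebra_simps)
    then have "t = z / (\<theta> + 2 * of_nat n * pi * \<i>)"
      using that(1) \<open>z \<noteq> 0\<close> by (metis divide_divide_eq_right nonzero_mult_div_cancel_left)
    then show False using that(2) unfolding exceptional_points_def by blast
  qed
  \<comment> \<open>Here the integer is shifted: z / t = \<theta> - 2 pi i (n + 1), so the zeros of
    \<open>Y_plus\<close> belong to k >= 1.\<close>
  have Sp: "1 - x + - c / t \<notin> \<int>\<^sub>\<le>\<^sub>0" if "t \<noteq> 0" "t \<notin> ?S" for t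
  proof
    assume "1 - x + - c / t \<in> \<int>\<^sub>\<le>\<^sub>0"
    then obtain n where n: "1 - x + - c / t = - of_nat n" by (elim nonpos_Ints_cases')
    then have "x + c / t = of_nat (Suc n)" by (simp add: algebra_simps)
    then have "z / t = \<theta> - 2 * of_nat (Suc n) * pi * \<i>"
      using twopi_x[of t] by (simp add: algebra_simps)
    then have "t = z / (\<theta> - 2 * of_nat (Suc n) * pi * \<i>)"
      using that(1) \<open>z \<noteq> 0\<close> by (metis divide_divide_eq_right nonzero_mult_div_cancel_left)
    then show False using that(2) unfolding exceptional_points_def by blast
  qed

  \<comment> \<open>Being a reciprocal Lambda, \<open>Y_plus\<close> has only zeros and no poles in
    its domain.\<close>
  have Yp_analytic: "Y_plus analytic_on ?Dp"
  proof (subst analytic_on_analytic_at, rule ballI)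
    fix t assume "t \<in> ?Dp"
    note t = Dp[OF this]
    have "\<forall>\<^sub>F s in nhds t. Y_plus s = inverse_Lambda (1 - x) (- c / s)"
      using t1_space_nhds[OF t(1)] by eventually_elim (rule Yp')
    then show "Y_plus analytic_on {t}"
      using analytic_inverse_Lambda[OF t] by (simp only: analytic_at_cong[OF _ refl])
  qed
  have Ym_analytic: "Y_minus analytic_on ?Dm - ?S"
    unfolding Ym by (subst analytic_on_analytic_at) (use Dm Sm in \<open>auto intro!: analytic_Lambda\<close>)

  \<comment> \<open>Away from poles of \<open>Y_minus\<close> the factor
    \<open>inverse_Lambda x (c / t)\<close> is nonzero and cancels against \<open>Y_minus t\<close>.
    At a pole the default value 0 would prevent this.\<close>
  have jump: "Y_plus t = Y_minus t * (inverse_Lambda x (c / t) * inverse_Lambda (1 - x) (- (c / t)))"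
    if "t \<noteq> 0" "Im (c / t) \<noteq> 0" "\<not> is_pole Y_minus t" for t
  proof -
    have "c / t \<notin> \<real>\<^sub>\<le>\<^sub>0" using that(2) by (auto simp: complex_nonpos_Reals_iff)
    then have "inverse_Lambda x (c / t) \<noteq> 0"
      using is_pole_Lambda[OF that(1)] that(3) by (auto simp: Ym inverse_Lambda_eq_0_iff)
    moreover have "Y_minus t = inverse (inverse_Lambda x (c / t))"
      using that(1) \<open>c \<noteq> 0\<close> by (simp add: Ym Lambda_eq_inverse)
    ultimately show ?thesis using Yp'[OF that(1)] by simp
  qed
  \<comment> \<open>The sign of Re (z / t), fixed on each half-plane, thus selects the case of the
    reflection formula.\<close>
  have Im_c: "Im (c / t) = Re (z / t) / (2 * pi)" for t
  proof -
    have "c / t = \<i> * (z / t) / of_real (2 * pi)" by (simp add: c_def)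
    then have "Im (c / t) = Im (\<i> * (z / t)) / (2 * pi)" by (simp only: Im_divide_of_real)
    then show ?thesis by (simp only: Im_i_times)
  qed
  have jump_upper: "Y_plus t = Y_minus t * (1 - \<xi> alpha * exp (- z / t))"
    if "t \<in> half_plane (ray z)" "\<not> is_pole Y_minus t" for t
  proof -
    note t = half_plane_ray_Re_pos[OF that(1) \<open>z \<noteq> 0\<close>]
    then have im: "Im (c / t) > 0" unfolding Im_c by simp
    have "exp (2 * pi * \<i> * (x + c / t)) = \<xi> alpha * exp (- z / t)"
      unfolding twopi_x by (simp add: exp_diff exp_minus exp_\<theta> divide_inverse)
    then show ?thesis
      using jump[OF t(1) _ that(2)] im inverse_Lambda_reflection(1)[of "c / t" x] \<open>c \<noteq> 0\<close> t(1) by simp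
  qed
  have jump_lower: "Y_plus t = Y_minus t * (1 - \<xi> (- alpha) * exp (z / t))"
    if "t \<in> half_plane (ray (- z))" "\<not> is_pole Y_minus t" for t
  proof -
    have t: "t \<noteq> 0" "0 < Re (- z / t)"
      using half_plane_ray_Re_pos[OF that(1)] \<open>z \<noteq> 0\<close> by auto
    then have im: "Im (c / t) < 0" unfolding Im_c by (simp add: divide_less_0_iff)
    have "exp (- (2 * pi * \<i> * (x + c / t))) = \<xi> (- alpha) * exp (z / t)"
      unfolding twopi_x twisted_torus_uminus_alpha[OF assms(2)]
      by (simp add: exp_diff exp_\<theta> divide_inverse mult.commute)
    then show ?thesis
      using jump[OF t(1) _ that(2)] im inverse_Lambda_reflection(2)[of "c / t" x] \<open>c \<noteq> 0\<close> t(1) by simp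
  qed

  have "limit_one_at_0 (- \<i> * z) Y_minus"
    unfolding limit_one_at_0_def Ym
    using \<open>z \<noteq> 0\<close> by (intro ballI tendsto_Lambda_at_0[where r = "1 / (2 * pi)"]) (auto simp: c_def)
  moreover have "limit_one_at_0 (\<i> * z) Y_plus"
    unfolding limit_one_at_0_def
  proof
    fix \<delta> assume \<delta>: "\<delta> \<in> {0<..<pi}"
    have "((\<lambda>t. Lambda (1 - x) (- c / t)) \<longlongrightarrow> 1) (at 0 within closed_subsector (\<i> * z) \<delta>)"
      using \<open>z \<noteq> 0\<close> \<delta> by (intro tendsto_Lambda_at_0[where r = "1 / (2 * pi)"]) (auto simp: c_def)
    from tendsto_inverse[OF this] show "(Y_plus \<longlongrightarrow> 1) (at 0 within closed_subsector (\<i> * z) \<delta>)"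
      by (simp add: Yp)
  qed
  moreover obtain m where "Lambda x \<in> O[at 0](\<lambda>y. 1 / y ^ m)"
    using bigo_Lambda by blast
  then have "algebraic_growth ?Dm Y_minus"
    by (rule algebraic_growth_compose_divide[OF _ \<open>c \<noteq> 0\<close>]) (simp add: Ym)
  moreover obtain m where "inverse_Lambda (1 - x) \<in> O[at 0](\<lambda>y. 1 / y ^ m)"
    using bigo_inverse_Lambda by blast
  then have "algebraic_growth ?Dp Y_plus"
    by (rule algebraic_growth_compose_divide[of _ _ "- c"])
       (use \<open>c \<noteq> 0\<close> eventually_not_equal_at_infinity[of 0] Yp' in \<open>auto elim: eventually_mono\<close>)
  moreover have "Y_plus nicely_meromorphic_on ?Dp"
    by (rule analytic_on_imp_nicely_meromorphic_on[OF Yp_analytic])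
  moreover have "Y_minus nicely_meromorphic_on ?Dm"
    unfolding Ym using Dm by (intro nicely_meromorphic_Lambda) auto
  moreover have "Y_plus holomorphic_on ?Dp - ?S"
    by (rule analytic_imp_holomorphic[OF analytic_on_subset[OF Yp_analytic]]) auto
  moreover have "Y_minus holomorphic_on ?Dm - ?S"
    by (rule analytic_imp_holomorphic[OF Ym_analytic])
  moreover have "Y_plus t \<noteq> 0" if "t \<in> ?Dp - ?S" for t
    using that Dp(1) Sp by (auto simp: Yp' inverse_Lambda_eq_0_iff)
  moreover have "Y_minus t \<noteq> 0" if "t \<in> ?Dm - ?S" for t
    using that Dm(1)[of t] Sm[of t] \<open>c \<noteq> 0\<close>
    by (auto simp: Ym Lambda_def Gamma_eq_zero_iff)
  ultimately show ?thesis
    unfolding solves_RH_problem_def Let_def assms(3,4)[symmetric]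
    using jump_upper jump_lower by blast
qed

end
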